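(* For any $f \in \mathbb{R}^n$, any $\lambda_1,\lambda_2 > 0$, and any diagonal matrices $W_1, W_2 \in \mathbb{R}^{2n\times 2n}$ with strictly positive diagonal entries, the quadratic function $$\mathcal{J}(x) = \frac12\|Sx-f\|_2^2+\frac{\lambda_1}{2}\|Gx\|_{W_1}^2+\frac{\lambda_2}{2}\|Rx\|_{W_2}^2,\qquad x\in\mathbb{R}^{3n},$$ is strictly convex. Hence $\mathcal{J}$ admits a unique global minimizer, given by the solution of the symmetric positive definite linear system yielded by the first-order optimality conditions: $$\nabla_x \mathcal{J}(x) = 0_{3n}\iff A(W_1,W_2)\,x = S^\top f,$$ where $$A(W_1,W_2) = S^\top S+\lambda_1 G^\top W_1 G+\lambda_2 R^\top W_2 R\in\mathbb{R}^{3n\times 3n}.$$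
   Context: Let $h,w\ge 2$ be integers and $n=hw$. For $m\ge 2$ let $B_m\in\mathbb{R}^{m\times m}$ be the matrix with $(B_m z)_i = z_{i+1}-z_i$ for $1\le i\le m-1$ and $(B_m z)_m = z_m-z_{m-1}$ (the last row repeats the previous one). Put $\nabla_x = I_h\otimes B_w$ and $\nabla_y = B_h\otimes I_w$ (Kronecker products, both in $\mathbb{R}^{n\times n}$), and let $\nabla = \begin{bmatrix}\nabla_x\\ \nabla_y\end{bmatrix}\in\mathbb{R}^{2n\times n}$ be the discrete gradient. Vectors in $\mathbb{R}^{3n}$ are written $x=(c,\xi)$ with $c\in\mathbb{R}^n$, $\xi\in\mathbb{R}^{2n}$. Define the block matrices $S=[\,I_n\;\; -\nabla^\top\,]\in\mathbb{R}^{n\times 3n}$, $G=[\,\nabla\;\; 0_{2n\times 2n}\,]\in\mathbb{R}^{2n\times 3n}$, $R=[\,0_{2n\times n}\;\; I_{2n}\,]\in\mathbb{R}^{2n\times 3n}$, so that $Sx=c-\nabla^\top\xi$, $Gx=\nabla c$, $Rx=\xi$. For $z\in\mathbb{R}^{2n}$ and $W\in\mathbb{R}^{2n\times 2n}$ symmetric positive definite, $\|z\|_W^2 := z^\top W z$. In $\nabla_x\mathcal{J}(x)$ the symbol $\nabla_x$ denotes the ordinary gradient of $\mathcal{J}$ with respect to $x\in\mathbb{R}^{3n}$. *)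

theory Defs
  imports "HOL-Analysis.Analysis"
begin

section \<open>Generic matrix notions\<close>

text \<open>
  \<open>hjoin A B\<close> is the block row \<open>[A B]\<close>. \<open>vjoin\<close> is used both for stacking vectors, \<open>(c, \<xi>)\<close>, and,
  since a matrix is the vector of its rows, for block columns.
\<close>

definition vjoin :: "'a ^ 'm \<Rightarrow> 'a ^ 'n \<Rightarrow> 'a ^ ('m + 'n)" where
  "vjoin u v = (\<chi> k. case k of Inl i \<Rightarrow> u $ i | Inr j \<Rightarrow> v $ j)"

definition hjoin :: "'a ^ 'm ^ 'r \<Rightarrow> 'a ^ 'n ^ 'r \<Rightarrow> 'a ^ ('m + 'n) ^ 'r" where
  "hjoin A B = (\<chi> i. vjoin (A $ i) (B $ i))"

definition kronecker :: "real ^ 'b ^ 'a \<Rightarrow> real ^ 'd ^ 'c \<Rightarrow> real ^ ('b \<times> 'd) ^ ('a \<times> 'c)" where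
  "kronecker A B = (\<chi> i j. A $ fst i $ fst j * B $ snd i $ snd j)"

definition diagonal_matrix :: "real ^ 'n ^ 'n \<Rightarrow> bool" where
  "diagonal_matrix W \<longleftrightarrow> (\<forall>i j. i \<noteq> j \<longrightarrow> W $ i $ j = 0)"

definition sym_pos_def :: "real ^ 'n ^ 'n \<Rightarrow> bool" where
  "sym_pos_def A \<longleftrightarrow> transpose A = A \<and> (\<forall>x. x \<noteq> 0 \<longrightarrow> x \<bullet> (A *v x) > 0)"

definition wnorm_sq :: "real ^ 'n ^ 'n \<Rightarrow> real ^ 'n \<Rightarrow> real" where
  "wnorm_sq W z = z \<bullet> (W *v z)"

definition strictly_convex_on :: "'a::real_vector set \<Rightarrow> ('a \<Rightarrow> real) \<Rightarrow> bool" where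
  "strictly_convex_on A f \<longleftrightarrow> convex A \<and>
     (\<forall>x\<in>A. \<forall>y\<in>A. x \<noteq> y \<longrightarrow>
        (\<forall>u>0. \<forall>v>0. u + v = 1 \<longrightarrow> f (u *\<^sub>R x + v *\<^sub>R y) < u * f x + v * f y))"

section \<open>The discrete gradient\<close>

text \<open>
  A finite linearly ordered type \<open>'m\<close> plays the role of \<open>{1..m}\<close> with \<open>m = CARD('m)\<close>: the successor
  of \<open>i\<close> is \<open>Min {i<..}\<close>, its predecessor is \<open>Max {..<i}\<close>, and the last index is \<open>Max UNIV\<close>.
  This is meaningful only for \<open>CARD('m) \<ge> 2\<close>.
\<close>

definition diff_op :: "real ^ ('m::{finite,linorder}) \<Rightarrow> real ^ ('m::{finite,linorder})" where
  "diff_op z = (\<chi> i. if i = Max UNIV then z $ i - z $ Max {..<i} else z $ Min {i<..} - z $ i)"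

definition diff_mat :: "real ^ ('m::{finite,linorder}) ^ ('m::{finite,linorder})" where
  "diff_mat = matrix diff_op"

lemma diff_mat_mult:
  fixes z :: "real ^ ('a::{finite,linorder})"
  shows "diff_mat *v z = diff_op z"
proof -
  have "linear (diff_op :: real ^ ('a::{finite,linorder}) \<Rightarrow> real ^ ('a::{finite,linorder}))"
    by (rule linearI) (auto simp: diff_op_def vec_eq_iff algebra_simps)
  then show ?thesis
    by (simp add: diff_mat_def matrix_works)
qed

text \<open>
  The grid with \<open>h = CARD('h)\<close> rows and \<open>w = CARD('w)\<close> columns is \<open>'h \<times> 'w\<close>, so \<open>n = CARD('h \<times> 'w)\<close>;
  vectors of length \<open>2n\<close> and \<open>3n\<close> are indexed by the sum types below.
\<close>

type_synonym ('h, 'w) grid = "'h \<times> 'w"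
type_synonym ('h, 'w) grid2 = "('h, 'w) grid + ('h, 'w) grid"
type_synonym ('h, 'w) grid3 = "('h, 'w) grid + ('h, 'w) grid2"

definition grad_x :: "real ^ ('h::{finite,linorder}, 'w::{finite,linorder}) grid ^ ('h, 'w) grid" where
  "grad_x = kronecker (mat 1) diff_mat"

definition grad_y :: "real ^ ('h::{finite,linorder}, 'w::{finite,linorder}) grid ^ ('h, 'w) grid" where
  "grad_y = kronecker diff_mat (mat 1)"

definition grad_mat :: "real ^ ('h::{finite,linorder}, 'w::{finite,linorder}) grid ^ ('h, 'w) grid2" where
  "grad_mat = vjoin grad_x grad_y"

section \<open>The objective and its system matrix\<close>

definition S_mat :: "real ^ ('h::{finite,linorder}, 'w::{finite,linorder}) grid3 ^ ('h, 'w) grid" where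
  "S_mat = hjoin (mat 1) (- transpose grad_mat)"

definition G_mat :: "real ^ ('h::{finite,linorder}, 'w::{finite,linorder}) grid3 ^ ('h, 'w) grid2" where
  "G_mat = hjoin grad_mat 0"

definition R_mat :: "real ^ ('h::{finite,linorder}, 'w::{finite,linorder}) grid3 ^ ('h, 'w) grid2" where
  "R_mat = hjoin 0 (mat 1)"

lemma hjoin_vjoin_mult: "hjoin A B *v vjoin u v = A *v u + B *v (v :: real ^ 'n)"
  by (simp add: vec_eq_iff hjoin_def vjoin_def matrix_vector_mult_def UNIV_Plus_UNIV [symmetric]
      sum.Plus o_def del: UNIV_Plus_UNIV)

lemma S_mat_mult:
  fixes c :: "real ^ ('a::{finite,linorder}, 'b::{finite,linorder}) grid"
  shows "S_mat *v vjoin c \<xi> = c - transpose grad_mat *v \<xi>"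
proof -
  have "(- M) *v \<xi> = - (M *v \<xi>)" for M :: "real ^ ('a, 'b) grid2 ^ ('a, 'b) grid"
    by (simp add: vec_eq_iff matrix_vector_mult_def sum_negf)
  then show ?thesis
    by (simp add: S_mat_def hjoin_vjoin_mult)
qed

lemma G_mat_mult: "G_mat *v vjoin c \<xi> = grad_mat *v c"
  by (simp add: G_mat_def hjoin_vjoin_mult)

lemma R_mat_mult: "R_mat *v vjoin c \<xi> = \<xi>"
  by (simp add: R_mat_def hjoin_vjoin_mult)

definition objective ::
  "real ^ ('h::{finite,linorder}, 'w::{finite,linorder}) grid \<Rightarrow> real \<Rightarrow> real \<Rightarrow>
   real ^ ('h, 'w) grid2 ^ ('h, 'w) grid2 \<Rightarrow> real ^ ('h, 'w) grid2 ^ ('h, 'w) grid2 \<Rightarrow>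
   real ^ ('h, 'w) grid3 \<Rightarrow> real" where
  "objective f lam\<^sub>1 lam\<^sub>2 W\<^sub>1 W\<^sub>2 x =
     1 / 2 * (norm (S_mat *v x - f))\<^sup>2
     + lam\<^sub>1 / 2 * wnorm_sq W\<^sub>1 (G_mat *v x)
     + lam\<^sub>2 / 2 * wnorm_sq W\<^sub>2 (R_mat *v x)"

definition system_mat ::
  "real \<Rightarrow> real \<Rightarrow>
   real ^ ('h::{finite,linorder}, 'w::{finite,linorder}) grid2 ^ ('h, 'w) grid2 \<Rightarrow>
   real ^ ('h, 'w) grid2 ^ ('h, 'w) grid2 \<Rightarrow>
   real ^ ('h, 'w) grid3 ^ ('h, 'w) grid3" where
  "system_mat lam\<^sub>1 lam\<^sub>2 W\<^sub>1 W\<^sub>2 =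
     transpose S_mat ** (S_mat :: real ^ ('h, 'w) grid3 ^ ('h, 'w) grid)
     + lam\<^sub>1 *\<^sub>R (transpose G_mat ** W\<^sub>1 ** G_mat)
     + lam\<^sub>2 *\<^sub>R (transpose R_mat ** W\<^sub>2 ** R_mat)"

end

theory Submission
  imports Defs
begin

text \<open>
  The objective is \<open>x \<mapsto> x \<bullet> A x / 2 - b \<bullet> x + const\<close> with \<open>b = S\<^sup>T f\<close>. The matrix \<open>A\<close> is positive definite
  because \<open>x \<bullet> A x = 0\<close> forces first \<open>\<xi> = R x = 0\<close> and then \<open>c = S x = 0\<close>; the term with \<open>G\<close> is only
  needed to be nonnegative. Everything else is the identity
  \<open>q (x + d) = q x + d \<bullet> (A x - b) + d \<bullet> A d / 2\<close>.
\<close>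

lemma inner_transpose_mult:
  fixes M :: "real ^ 'n ^ 'm"
  shows "x \<bullet> (transpose M *v y) = (M *v x) \<bullet> y"
  by (metis dot_lmul_matrix inner_commute transpose_matrix_vector)

lemma matrix_scaleR_vector_mult:
  fixes M :: "real ^ 'n ^ 'm"
  shows "(r *\<^sub>R M) *v x = r *\<^sub>R (M *v x)"
  by (simp add: vec_eq_iff matrix_vector_mult_def sum_distrib_left mult.assoc)

lemma transpose_scaleR:
  fixes M :: "real ^ 'n ^ 'm"
  shows "transpose (r *\<^sub>R M) = r *\<^sub>R transpose M"
  by (simp add: vec_eq_iff transpose_def)

lemma transpose_add:
  fixes M N :: "real ^ 'n ^ 'm"
  shows "transpose (M + N) = transpose M + transpose N"
  by (simp add: vec_eq_iff transpose_def)

lemma diagonal_matrix_mult_nth: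
  assumes "diagonal_matrix W"
  shows "(W *v x) $ i = W $ i $ i * x $ i"
proof -
  have "(\<Sum>j\<in>UNIV. W $ i $ j * x $ j) = (\<Sum>j\<in>UNIV. if j = i then W $ i $ i * x $ i else 0)"
    using assms by (intro sum.cong) (auto simp: diagonal_matrix_def)
  then show ?thesis
    by (simp add: matrix_vector_mult_def)
qed

text \<open>The form is a sum of squares with positive weights, and a nonzero coordinate of
  \<open>x\<close> contributes a positive term.\<close>

lemma diagonal_sym_pos_def:
  fixes W :: "real ^ 'n ^ 'n"
  assumes W: "diagonal_matrix W" and pos: "\<And>i. W $ i $ i > 0"
  shows "sym_pos_def W"
  unfolding sym_pos_def_def
proof (intro conjI allI impI)
  show "transpose W = W"
    using W unfolding diagonal_matrix_def transpose_def vec_eq_iff by (metis vec_lambda_beta)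
next
  fix x :: "real ^ 'n"
  assume "x \<noteq> 0"
  then obtain k where k: "x $ k \<noteq> 0"
    by (auto simp: vec_eq_iff)
  have "x \<bullet> (W *v x) = (\<Sum>i\<in>UNIV. W $ i $ i * (x $ i)\<^sup>2)"
    by (simp add: inner_vec_def diagonal_matrix_mult_nth [OF W] power2_eq_square algebra_simps)
  also have "\<dots> > 0"
    by (rule sum_pos2 [of _ k]) (use k pos in \<open>auto simp: less_imp_le\<close>)
  finally show "x \<bullet> (W *v x) > 0" .
qed

lemma sym_pos_def_nonneg: "sym_pos_def A \<Longrightarrow> x \<bullet> (A *v x) \<ge> 0"
  by (cases "x = 0") (auto simp: sym_pos_def_def less_imp_le)

lemma sym_pos_def_inner_commute:
  assumes "sym_pos_def A"
  shows "x \<bullet> (A *v y) = y \<bullet> (A *v x)"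
  by (metis assms inner_commute inner_transpose_mult sym_pos_def_def)

text \<open>Definiteness makes the kernel trivial, and an injective linear map of a
  finite-dimensional space to itself is onto.\<close>

lemma sym_pos_def_solvable:
  fixes A :: "real ^ 'n ^ 'n"
  assumes "sym_pos_def A"
  shows "\<exists>!x. A *v x = b"
proof -
  have inj: "inj ((*v) A)"
  proof (rule injI)
    fix x y
    assume "A *v x = A *v y"
    then have "(x - y) \<bullet> (A *v (x - y)) = 0"
      by (simp add: matrix_vector_mult_diff_distrib)
    then show "x = y"
      using assms unfolding sym_pos_def_def by (metis less_irrefl right_minus_eq)
  qed
  then have "surj ((*v) A)"
    by (simp add: linear_injective_imp_surjective)
  with inj show ?thesis
    by (metis injD surjD)
qed

definition quadratic :: "real ^ 'n ^ 'n \<Rightarrow> real ^ 'n \<Rightarrow> real \<Rightarrow> real ^ 'n \<Rightarrow> real" where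
  "quadratic A b k x = x \<bullet> (A *v x) / 2 - b \<bullet> x + k"

text \<open>This is the exact second-order Taylor formula: symmetry of \<open>A\<close> merges the
  two mixed terms into the single term linear in \<open>d\<close>.\<close>

lemma quadratic_expansion:
  assumes "sym_pos_def A"
  shows "quadratic A b k (x + d) = quadratic A b k x + d \<bullet> (A *v x - b) + d \<bullet> (A *v d) / 2"
  using sym_pos_def_inner_commute [OF assms, of x d]
  by (simp add: quadratic_def matrix_vector_right_distrib inner_add inner_diff inner_commute
      field_simps)

text \<open>On the line through \<open>x\<close> and \<open>y\<close> the function is a parabola
  with leading coefficient \<open>q / 2\<close>, where \<open>q\<close> is positive by
  definiteness.\<close>

lemma strictly_convex_quadratic:
  assumes A: "sym_pos_def A"
  shows "strictly_convex_on UNIV (quadratic A b k)"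
  unfolding strictly_convex_on_def
proof (intro conjI ballI impI allI)
  fix x y :: "real ^ 'a" and u v :: real
  assume "x \<noteq> y" and u: "u > 0" and v: "v > 0" and uv: "u + v = 1"
  define z where "z = u *\<^sub>R x + v *\<^sub>R y"
  define e where "e = x - y"
  define q where "q = e \<bullet> (A *v e)"
  define g where "g = e \<bullet> (A *v z - b)"
  have q: "q > 0"
    using A \<open>x \<noteq> y\<close> by (simp add: sym_pos_def_def q_def e_def)
  have u': "u = 1 - v"
    using uv by simp
  \<comment> \<open>Seen from \<open>z\<close> in direction \<open>e\<close>, the endpoints sit at
    parameters \<open>v\<close> and \<open>- u\<close>.\<close>
  have x: "x = z + v *\<^sub>R e" and y: "y = z + (- u) *\<^sub>R e"
    by (simp_all add: z_def e_def u' algebra_simps)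
  have along: "quadratic A b k (z + t *\<^sub>R e) = quadratic A b k z + t * g + t\<^sup>2 * q / 2" for t
    by (simp add: quadratic_expansion [OF A] g_def q_def matrix_vector_mult_scaleR power2_eq_square)
  \<comment> \<open>The slope \<open>g\<close> enters with factor \<open>u * v - v * u\<close>,
    which vanishes; only the quadratic terms remain as the convexity gap.\<close>
  have "u * quadratic A b k x + v * quadratic A b k y =
      (u + v) * quadratic A b k z + (u * v\<^sup>2 + v * u\<^sup>2) * q / 2"
    by (subst x, subst y, subst along, subst along) (simp add: field_simps)
  moreover have "(u * v\<^sup>2 + v * u\<^sup>2) * q / 2 > 0"
    using u v q by (simp add: add_pos_pos)
  ultimately show "quadratic A b k (u *\<^sub>R x + v *\<^sub>R y) <
      u * quadratic A b k x + v * quadratic A b k y"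
    using uv by (simp add: z_def)
qed simp

text \<open>The product rule yields two terms that agree by symmetry of \<open>A\<close>, which
  cancels the factor 1/2.\<close>

lemma GDERIV_quadratic:
  assumes "sym_pos_def A"
  shows "GDERIV (quadratic A b k) x :> (A *v x - b)"
proof -
  have "((*v) A has_derivative (*v) A) (at x)"
    by (simp add: bounded_linear_imp_has_derivative)
  then have "((\<lambda>x. x \<bullet> (A *v x) / 2 - b \<bullet> x + k) has_derivative
      (\<lambda>h. (x \<bullet> (A *v h) + h \<bullet> (A *v x)) / 2 - b \<bullet> h)) (at x)"
    by (auto intro!: derivative_eq_intros)
  moreover have "(x \<bullet> (A *v h) + h \<bullet> (A *v x)) / 2 - b \<bullet> h = h \<bullet> (A *v x - b)" for h
    by (simp add: sym_pos_def_inner_commute [OF assms, of x h] inner_diff_right inner_commute [of b])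
  ultimately show ?thesis
    by (simp add: gderiv_def quadratic_def [abs_def])
qed

lemma quadratic_differentiable:
  assumes "sym_pos_def A"
  shows "quadratic A b k differentiable (at x)"
  using GDERIV_quadratic [OF assms] unfolding gderiv_def differentiable_def by blast

text \<open>At a minimizer the derivative vanishes. Conversely, at a solution the expansion loses
  its linear term and keeps a nonnegative quadratic one.\<close>

lemma quadratic_minimizer_iff:
  assumes A: "sym_pos_def A"
  shows "(\<forall>y. quadratic A b k x \<le> quadratic A b k y) \<longleftrightarrow> A *v x = b"
proof
  assume min: "\<forall>y. quadratic A b k x \<le> quadratic A b k y"
  have "(\<lambda>h. h \<bullet> (A *v x - b)) = (\<lambda>h. 0)"
    using GDERIV_quadratic [OF A, of b k x] min unfolding gderiv_def
    by (intro differential_zero_maxmin [of x UNIV "quadratic A b k"]) auto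
  \<comment> \<open>Taking \<open>h\<close> to be \<open>A *v x - b\<close> itself gives a vector
    with zero inner square.\<close>
  then show "A *v x = b"
    by (metis inner_eq_zero_iff right_minus_eq)
next
  assume "A *v x = b"
  then have "quadratic A b k x \<le> quadratic A b k y" for y
    using quadratic_expansion [OF A, of b k x "y - x"] sym_pos_def_nonneg [OF A, of "y - x"]
    by simp
  then show "\<forall>y. quadratic A b k x \<le> quadratic A b k y"
    by blast
qed

lemma GDERIV_quadratic_zero_iff:
  assumes A: "sym_pos_def A"
  shows "(GDERIV (quadratic A b k) x :> 0) \<longleftrightarrow> A *v x = b"
proof
  assume "GDERIV (quadratic A b k) x :> 0"
  with GDERIV_quadratic [OF A, of b k x] have "(\<lambda>h. h \<bullet> (A *v x - b)) = (\<lambda>h. h \<bullet> 0)"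
    unfolding gderiv_def by (rule has_derivative_unique)
  then show "A *v x = b"
    by (metis inner_eq_zero_iff inner_zero_right right_minus_eq)
next
  assume "A *v x = b"
  then show "GDERIV (quadratic A b k) x :> 0"
    using GDERIV_quadratic [OF A, of b k x] by simp
qed

text \<open>Stacked, \<open>S_mat\<close> and \<open>R_mat\<close> form a block triangular matrix
  with identity diagonal blocks, hence an injective one.\<close>

lemma S_R_mat_kernel:
  assumes S: "S_mat *v x = 0" and R: "R_mat *v x = 0"
  shows "x = 0"
proof -
  define c where "c = (\<chi> i. x $ Inl i)"
  define \<xi> where "\<xi> = (\<chi> j. x $ Inr j)"
  have x: "x = vjoin c \<xi>"
    by (simp add: vec_eq_iff vjoin_def c_def \<xi>_def split: sum.split)
  with R have "\<xi> = 0"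
    by (simp add: R_mat_mult)
  with S x have "c = 0"
    by (simp add: S_mat_mult)
  with x \<open>\<xi> = 0\<close> show ?thesis
    by (simp add: vec_eq_iff vjoin_def split: sum.split)
qed

lemma system_mat_mult:
  "system_mat lam\<^sub>1 lam\<^sub>2 W\<^sub>1 W\<^sub>2 *v x =
     transpose S_mat *v (S_mat *v x) + lam\<^sub>1 *\<^sub>R (transpose G_mat *v (W\<^sub>1 *v (G_mat *v x)))
     + lam\<^sub>2 *\<^sub>R (transpose R_mat *v (W\<^sub>2 *v (R_mat *v x)))"
  by (simp add: system_mat_def matrix_vector_mult_add_rdistrib matrix_scaleR_vector_mult
      matrix_vector_mul_assoc [symmetric])

text \<open>Moving each transposed factor across the inner product shows that this form is twice the
  homogeneous quadratic part of \<open>objective\<close>.\<close>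

lemma inner_system_mat:
  "x \<bullet> (system_mat lam\<^sub>1 lam\<^sub>2 W\<^sub>1 W\<^sub>2 *v x) =
     (norm (S_mat *v x))\<^sup>2 + lam\<^sub>1 * wnorm_sq W\<^sub>1 (G_mat *v x) + lam\<^sub>2 * wnorm_sq W\<^sub>2 (R_mat *v x)"
  by (simp add: system_mat_mult inner_add_right inner_transpose_mult wnorm_sq_def
      power2_norm_eq_inner del: transpose_matrix_vector)

text \<open>Expanding the square of the residual gives a cross term that the adjoint turns into the
  linear part, and the constant from \<open>f\<close>. The facts about \<open>quadratic\<close>
  thereby transfer to the objective.\<close>

lemma objective_eq_quadratic:
  "objective f lam\<^sub>1 lam\<^sub>2 W\<^sub>1 W\<^sub>2 =
     quadratic (system_mat lam\<^sub>1 lam\<^sub>2 W\<^sub>1 W\<^sub>2) (transpose S_mat *v f) ((norm f)\<^sup>2 / 2)"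
proof
  fix x
  have "(transpose S_mat *v f) \<bullet> x = (S_mat *v x) \<bullet> f"
    by (simp add: inner_commute [of _ x] inner_transpose_mult
        del: transpose_matrix_vector)
  then show "objective f lam\<^sub>1 lam\<^sub>2 W\<^sub>1 W\<^sub>2 x =
      quadratic (system_mat lam\<^sub>1 lam\<^sub>2 W\<^sub>1 W\<^sub>2) (transpose S_mat *v f) ((norm f)\<^sup>2 / 2) x"
    by (simp add: objective_def quadratic_def inner_system_mat power2_norm_eq_inner inner_diff
        inner_commute [of f "S_mat *v x"] add_divide_distrib diff_divide_distrib del: transpose_matrix_vector)
qed

lemma sym_pos_def_system_mat:
  assumes "lam\<^sub>1 \<ge> 0" and "lam\<^sub>2 > 0" and W1: "sym_pos_def W\<^sub>1" and W2: "sym_pos_def W\<^sub>2"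
  shows "sym_pos_def (system_mat lam\<^sub>1 lam\<^sub>2 W\<^sub>1 W\<^sub>2)"
  unfolding sym_pos_def_def
proof (intro conjI allI impI)
  have "transpose W\<^sub>1 = W\<^sub>1" "transpose W\<^sub>2 = W\<^sub>2"
    using W1 W2 by (auto simp: sym_pos_def_def)
  then show "transpose (system_mat lam\<^sub>1 lam\<^sub>2 W\<^sub>1 W\<^sub>2) = system_mat lam\<^sub>1 lam\<^sub>2 W\<^sub>1 W\<^sub>2"
    by (simp add: system_mat_def transpose_add transpose_scaleR matrix_transpose_mul
        matrix_mul_assoc)
next
  fix x :: "real ^ ('a, 'b) grid3"
  assume "x \<noteq> 0"
  let ?S = "(norm (S_mat *v x))\<^sup>2"
    and ?G = "lam\<^sub>1 * wnorm_sq W\<^sub>1 (G_mat *v x)"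
    and ?R = "lam\<^sub>2 * wnorm_sq W\<^sub>2 (R_mat *v x)"
  have "?G \<ge> 0" and "?R \<ge> 0"
    using assms by (auto simp: wnorm_sq_def sym_pos_def_nonneg)
  \<comment> \<open>If \<open>R_mat *v x\<close> is nonzero, \<open>W\<^sub>2\<close> makes the last
    term positive; otherwise the trivial common kernel forces \<open>S_mat *v x\<close> to be
    nonzero.\<close>
  moreover have "?S > 0 \<or> ?R > 0"
  proof (cases "R_mat *v x = 0")
    case True
    then show ?thesis
      using S_R_mat_kernel \<open>x \<noteq> 0\<close> by auto
  next
    case False
    then show ?thesis
      using W2 \<open>lam\<^sub>2 > 0\<close> by (simp add: sym_pos_def_def wnorm_sq_def)
  qed
  ultimately have "?S + ?G + ?R > 0"
    by (smt (verit) zero_le_power2)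
  then show "x \<bullet> (system_mat lam\<^sub>1 lam\<^sub>2 W\<^sub>1 W\<^sub>2 *v x) > 0"
    by (simp only: inner_system_mat)
qed

theorem proposition3p1:
  fixes f :: "real ^ ('h::{finite,linorder}, 'w::{finite,linorder}) grid"
    and lam\<^sub>1 lam\<^sub>2 :: real
    and W\<^sub>1 W\<^sub>2 :: "real ^ ('h, 'w) grid2 ^ ('h, 'w) grid2"
  assumes "CARD('h) \<ge> 2" and "CARD('w) \<ge> 2"
    and "lam\<^sub>1 > 0" and "lam\<^sub>2 > 0"
    and "diagonal_matrix W\<^sub>1" and "\<And>i. W\<^sub>1 $ i $ i > 0"
    and "diagonal_matrix W\<^sub>2" and "\<And>i. W\<^sub>2 $ i $ i > 0"
  shows "strictly_convex_on UNIV (objective f lam\<^sub>1 lam\<^sub>2 W\<^sub>1 W\<^sub>2)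
    \<and> (\<exists>!x. \<forall>y. objective f lam\<^sub>1 lam\<^sub>2 W\<^sub>1 W\<^sub>2 x \<le> objective f lam\<^sub>1 lam\<^sub>2 W\<^sub>1 W\<^sub>2 y)
    \<and> (\<forall>x. (\<forall>y. objective f lam\<^sub>1 lam\<^sub>2 W\<^sub>1 W\<^sub>2 x \<le> objective f lam\<^sub>1 lam\<^sub>2 W\<^sub>1 W\<^sub>2 y) \<longleftrightarrow>
             system_mat lam\<^sub>1 lam\<^sub>2 W\<^sub>1 W\<^sub>2 *v x = transpose S_mat *v f)
    \<and> sym_pos_def (system_mat lam\<^sub>1 lam\<^sub>2 W\<^sub>1 W\<^sub>2)
    \<and> (\<forall>x. objective f lam\<^sub>1 lam\<^sub>2 W\<^sub>1 W\<^sub>2 differentiable (at x))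
    \<and> (\<forall>x. (GDERIV (objective f lam\<^sub>1 lam\<^sub>2 W\<^sub>1 W\<^sub>2) x :> 0) \<longleftrightarrow>
             system_mat lam\<^sub>1 lam\<^sub>2 W\<^sub>1 W\<^sub>2 *v x = transpose S_mat *v f)"
proof -
  have A: "sym_pos_def (system_mat lam\<^sub>1 lam\<^sub>2 W\<^sub>1 W\<^sub>2)"
    using assms by (intro sym_pos_def_system_mat diagonal_sym_pos_def) auto
  \<comment> \<open>Minimality and vanishing gradient both become the same linear system, so unique
    solvability yields the unique minimizer.\<close>
  show ?thesis
    unfolding objective_eq_quadratic
    using A strictly_convex_quadratic [OF A] sym_pos_def_solvable [OF A]
      quadratic_differentiable [OF A]
    by (simp add: quadratic_minimizer_iff GDERIV_quadratic_zero_iff del: transpose_matrix_vector)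
qed

end
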